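(* Let $R$ be a commutative ring with identity and $M$ an $R$-module. Let $H$ be a submodule of $M$ such that for all ideals $I$ and $J$ of $R$, $(H:_M I)\subseteq (H:_M J)$ implies $J\subseteq I$. Then $H$ is a second submodule of $M$ if and only if $H$ is a $\psi_1$-second submodule of $M$.
   Context: For a submodule $H$ of $M$ and an ideal $I$ of $R$, $(H:_M I)=\{m\in M: Im\subseteq H\}$, and $Ann_R(H)=\{r\in R: rH=0\}$. A non-zero submodule $N$ of $M$ is called second if for each $a\in R$ either $aN=N$ or $aN=0$. Let $S(M)$ be the set of submodules of $M$. For a function $\psi: S(M)\to S(M)\cup\{\emptyset\}$, a non-zero submodule $N$ of $M$ is called $\psi$-second if for all $r\in R$ and all submodules $K$ of $M$ with $rN\subseteq K$ and $r\psi(N)\not\subseteq K$, one has $N\subseteq K$ or $rN=0$. The function $\psi_1$ is $\psi_1(N)=(N:_M Ann_R(N))$ for $N\in S(M)$. *)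

theory Defs
  imports "HOL-Algebra.Module" "HOL-Algebra.Ideal"
begin

definition smult_image :: "('a, 'b, 'm) module_scheme \<Rightarrow> 'a \<Rightarrow> 'b set \<Rightarrow> 'b set" where
  "smult_image M r N = (\<lambda>x. r \<odot>\<^bsub>M\<^esub> x) ` N"

definition annihilator ::
  "('a, 'r) ring_scheme \<Rightarrow> ('a, 'b, 'm) module_scheme \<Rightarrow> 'b set \<Rightarrow> 'a set" where
  "annihilator R M H = {r \<in> carrier R. smult_image M r H = {\<zero>\<^bsub>M\<^esub>}}"

text \<open>The residual \<open>(H :\<^sub>M I)\<close>. The condition \<open>I m \<subseteq> H\<close> is written elementwise; \<open>R\<close> enters
  only through \<open>I\<close>.\<close>

definition residual ::
  "('a, 'b, 'm) module_scheme \<Rightarrow> 'b set \<Rightarrow> 'a set \<Rightarrow> 'b set" where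
  "residual M H I = {m \<in> carrier M. \<forall>i\<in>I. i \<odot>\<^bsub>M\<^esub> m \<in> H}"

definition second_submodule ::
  "('a, 'r) ring_scheme \<Rightarrow> ('a, 'b, 'm) module_scheme \<Rightarrow> 'b set \<Rightarrow> bool" where
  "second_submodule R M N \<longleftrightarrow>
     submodule N R M \<and> N \<noteq> {\<zero>\<^bsub>M\<^esub>} \<and>
     (\<forall>a\<in>carrier R. smult_image M a N = N \<or> smult_image M a N = {\<zero>\<^bsub>M\<^esub>})"

text \<open>A function \<open>\<psi> : S(M) \<rightarrow> S(M) \<union> {\<emptyset>}\<close> is represented by a total function on sets; only its
  values on submodules matter. The requirement that these values be submodules or empty is not
  part of the definition: for the function \<open>psi1\<close> below it is a theorem.\<close>

definition psi_second_submodule ::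
  "('a, 'r) ring_scheme \<Rightarrow> ('a, 'b, 'm) module_scheme \<Rightarrow> ('b set \<Rightarrow> 'b set) \<Rightarrow> 'b set \<Rightarrow> bool" where
  "psi_second_submodule R M \<psi> N \<longleftrightarrow>
     submodule N R M \<and> N \<noteq> {\<zero>\<^bsub>M\<^esub>} \<and>
     (\<forall>r\<in>carrier R. \<forall>K. submodule K R M \<longrightarrow>
        smult_image M r N \<subseteq> K \<longrightarrow> \<not> smult_image M r (\<psi> N) \<subseteq> K \<longrightarrow>
        N \<subseteq> K \<or> smult_image M r N = {\<zero>\<^bsub>M\<^esub>})"

definition psi1 ::
  "('a, 'r) ring_scheme \<Rightarrow> ('a, 'b, 'm) module_scheme \<Rightarrow> 'b set \<Rightarrow> 'b set" where
  "psi1 R M N = residual M N (annihilator R M N)"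

lemma (in module) residual_submodule:
  assumes N: "submodule N R M" and I: "I \<subseteq> carrier R"
  shows "submodule (residual M N I) R M"
proof -
  interpret N: submodule N R M by (rule N)
  have zero: "\<zero>\<^bsub>M\<^esub> \<in> N"
    using N.one_closed by simp
  show ?thesis
  proof (rule submoduleI)
    show "residual M N I \<subseteq> carrier M"
      by (auto simp: residual_def)
    show "\<zero>\<^bsub>M\<^esub> \<in> residual M N I"
      using I zero by (auto simp: residual_def)
    show "\<ominus>\<^bsub>M\<^esub> a \<in> residual M N I" if "a \<in> residual M N I" for a
      using that I submoduleE(3)[OF N] by (auto simp: residual_def smult_r_minus subset_iff)
    show "a \<oplus>\<^bsub>M\<^esub> b \<in> residual M N I" if "a \<in> residual M N I" "b \<in> residual M N I" for a b
      using that I submoduleE(5)[OF N] by (auto simp: residual_def smult_r_distr subset_iff)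
    show "a \<odot>\<^bsub>M\<^esub> x \<in> residual M N I" if a: "a \<in> carrier R" and x: "x \<in> residual M N I" for a x
    proof -
      have "i \<odot>\<^bsub>M\<^esub> (a \<odot>\<^bsub>M\<^esub> x) \<in> N" if i: "i \<in> I" for i
      proof -
        have "i \<odot>\<^bsub>M\<^esub> (a \<odot>\<^bsub>M\<^esub> x) = a \<odot>\<^bsub>M\<^esub> (i \<odot>\<^bsub>M\<^esub> x)"
          using a i I x by (auto simp: residual_def smult_assoc1[symmetric] R.m_comm subset_iff)
        also have "\<dots> \<in> N"
          using a i x by (auto simp: residual_def)
        finally show ?thesis .
      qed
      then show ?thesis
        using a x by (auto simp: residual_def)
    qed
  qed
qed

lemma (in module) psi1_submodule:
  assumes "submodule N R M"
  shows "submodule (psi1 R M N) R M"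
  unfolding psi1_def using assms
  by (rule residual_submodule) (auto simp: annihilator_def)

end

theory Submission
  imports Defs
begin

text \<open>For the nontrivial direction, test the \<open>\<psi>\<^sub>1\<close>-second condition on \<open>K = r H\<close>. If
  \<open>r \<psi>\<^sub>1(H) \<subseteq> r H\<close>, then \<open>(H :\<^sub>M Ann H) \<subseteq> (H :\<^sub>M (r))\<close>, so the hypothesis on residuals gives
  \<open>(r) \<subseteq> Ann H\<close>, that is \<open>r H = 0\<close>. Otherwise the condition yields \<open>H \<subseteq> r H\<close> or \<open>r H = 0\<close>.\<close>

context module
begin

text \<open>A submodule contains zero, so its image under \<open>r\<close> is nonempty; being equal
  to the singleton of zero is then the same as vanishing at every element.\<close>

lemma smult_image_eq_zero_iff:
  assumes "submodule H R M"
  shows "smult_image M r H = {\<zero>\<^bsub>M\<^esub>} \<longleftrightarrow> (\<forall>x\<in>H. r \<odot>\<^bsub>M\<^esub> x = \<zero>\<^bsub>M\<^esub>)"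
  using submoduleE(2)[OF assms] by (auto simp: smult_image_def)

lemma smult_image_subset:
  assumes "submodule H R M" and "r \<in> carrier R"
  shows "smult_image M r H \<subseteq> H"
  using submoduleE(4)[OF assms(1)] assms(2) by (auto simp: smult_image_def)

text \<open>Makes \<open>r H\<close> admissible as the test submodule \<open>K\<close>. Closure
  under scalars rests on commutativity of \<open>R\<close>: c (r x) = r (c x).\<close>

lemma smult_image_submodule:
  assumes H: "submodule H R M" and r: "r \<in> carrier R"
  shows "submodule (smult_image M r H) R M"
proof -
  have carr: "x \<in> carrier M" if "x \<in> H" for x
    using submoduleE(1)[OF H] that by blast
  have zero: "\<zero>\<^bsub>M\<^esub> \<in> H"
    using submodule.axioms(1)[OF H] subgroup.one_closed by fastforce
  show ?thesis
  proof (rule submoduleI)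
    show "smult_image M r H \<subseteq> carrier M"
      using r carr by (auto simp: smult_image_def)
    show "\<zero>\<^bsub>M\<^esub> \<in> smult_image M r H"
      using r zero unfolding smult_image_def by (metis image_eqI smult_r_null)
  next
    fix a assume "a \<in> smult_image M r H"
    then obtain x where x: "x \<in> H" "a = r \<odot>\<^bsub>M\<^esub> x"
      by (auto simp: smult_image_def)
    then have "\<ominus>\<^bsub>M\<^esub> a = r \<odot>\<^bsub>M\<^esub> (\<ominus>\<^bsub>M\<^esub> x)"
      using r carr by (simp add: smult_r_minus)
    then show "\<ominus>\<^bsub>M\<^esub> a \<in> smult_image M r H"
      using x submoduleE(3)[OF H] by (auto simp: smult_image_def)
  next
    fix a b assume "a \<in> smult_image M r H" "b \<in> smult_image M r H"
    then obtain x y where xy: "x \<in> H" "a = r \<odot>\<^bsub>M\<^esub> x" "y \<in> H" "b = r \<odot>\<^bsub>M\<^esub> y"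
      by (auto simp: smult_image_def)
    then have "a \<oplus>\<^bsub>M\<^esub> b = r \<odot>\<^bsub>M\<^esub> (x \<oplus>\<^bsub>M\<^esub> y)"
      using r carr by (simp add: smult_r_distr)
    then show "a \<oplus>\<^bsub>M\<^esub> b \<in> smult_image M r H"
      using xy submoduleE(5)[OF H] by (auto simp: smult_image_def)
  next
    fix c a assume c: "c \<in> carrier R" and "a \<in> smult_image M r H"
    then obtain x where x: "x \<in> H" "a = r \<odot>\<^bsub>M\<^esub> x"
      by (auto simp: smult_image_def)
    then have "c \<odot>\<^bsub>M\<^esub> a = r \<odot>\<^bsub>M\<^esub> (c \<odot>\<^bsub>M\<^esub> x)"
      using r c carr by (simp add: smult_assoc1[symmetric] R.m_comm)
    then show "c \<odot>\<^bsub>M\<^esub> a \<in> smult_image M r H"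
      using x c submoduleE(4)[OF H] by (auto simp: smult_image_def)
  qed
qed

text \<open>The hypothesis on residuals speaks of ideals only, so it can be applied to the
  annihilator only once this is known.\<close>

lemma annihilator_ideal:
  assumes H: "submodule H R M"
  shows "ideal (annihilator R M H) R"
proof -
  have carr: "x \<in> carrier M" if "x \<in> H" for x
    using submoduleE(1)[OF H] that by blast
  have mem: "a \<in> annihilator R M H \<longleftrightarrow> a \<in> carrier R \<and> (\<forall>x\<in>H. a \<odot>\<^bsub>M\<^esub> x = \<zero>\<^bsub>M\<^esub>)" for a
    by (simp add: annihilator_def smult_image_eq_zero_iff[OF H])
  have mult: "x \<otimes>\<^bsub>R\<^esub> a \<in> annihilator R M H"
    if "a \<in> annihilator R M H" "x \<in> carrier R" for a x
    using that carr by (auto simp: mem smult_assoc1)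
  show ?thesis
  proof (rule idealI)
    show "ring R"
      by (rule R.ring_axioms)
    show "subgroup (annihilator R M H) (add_monoid R)"
    proof (rule R.add.subgroupI)
      show "annihilator R M H \<subseteq> carrier R"
        by (auto simp: mem)
      show "annihilator R M H \<noteq> {}"
        using mem[of "\<zero>\<^bsub>R\<^esub>"] carr by auto
    qed (use carr in \<open>auto simp: mem smult_l_minus smult_l_distr\<close>)
    show "x \<otimes>\<^bsub>R\<^esub> a \<in> annihilator R M H"
      if "a \<in> annihilator R M H" "x \<in> carrier R" for a x
      using mult that .
    show "a \<otimes>\<^bsub>R\<^esub> x \<in> annihilator R M H"
      if "a \<in> annihilator R M H" "x \<in> carrier R" for a x
      using mult[OF that] that by (simp add: mem R.m_comm)
  qed
qed

text \<open>The elements of the principal ideal are the products a r, and (a r) m = a (r m) stays in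
  \<open>H\<close> once r m does. Conversely, \<open>r\<close> itself lies in the ideal.\<close>

lemma residual_cgenideal:
  assumes H: "submodule H R M" and r: "r \<in> carrier R"
  shows "residual M H (PIdl\<^bsub>R\<^esub> r) = {m \<in> carrier M. r \<odot>\<^bsub>M\<^esub> m \<in> H}"
  using r submoduleE(4)[OF H] R.cgenideal_self[OF r]
  by (auto simp: residual_def cgenideal_def smult_assoc1)

text \<open>If r H = H, the inclusion of r H in \<open>K\<close> already says that \<open>H\<close>
  lies in \<open>K\<close>; otherwise r H = 0. This argument works for every
  \<open>\<psi>\<close>.\<close>

lemma second_imp_psi_second:
  assumes "second_submodule R M H"
  shows "psi_second_submodule R M \<psi> H"
  using assms unfolding second_submodule_def psi_second_submodule_def by metis

lemma psi1_second_imp_second: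
  assumes psi: "psi_second_submodule R M (psi1 R M) H"
    and res: "\<And>I J. ideal I R \<Longrightarrow> ideal J R \<Longrightarrow> residual M H I \<subseteq> residual M H J \<Longrightarrow> J \<subseteq> I"
  shows "second_submodule R M H"
proof -
  have H: "submodule H R M"
    using psi by (simp add: psi_second_submodule_def)
  have "smult_image M r H = H \<or> smult_image M r H = {\<zero>\<^bsub>M\<^esub>}" if r: "r \<in> carrier R" for r
  proof (cases "smult_image M r (psi1 R M H) \<subseteq> smult_image M r H")
    case True
    \<comment> \<open>The inclusion is weakened from r H to \<open>H\<close> because membership in
      the residual by (r) only asks that r m lie in \<open>H\<close>.\<close>
    then have "smult_image M r (psi1 R M H) \<subseteq> H"
      using smult_image_subset[OF H r] by blast
    then have "residual M H (annihilator R M H) \<subseteq> residual M H (PIdl\<^bsub>R\<^esub> r)"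
      unfolding residual_cgenideal[OF H r]
      by (auto simp: psi1_def smult_image_def residual_def)
    \<comment> \<open>The hypothesis reverses the inclusion of residuals, taken with I = Ann H and J
      = (r).\<close>
    then have "PIdl\<^bsub>R\<^esub> r \<subseteq> annihilator R M H"
      by (rule res[OF annihilator_ideal[OF H] R.cgenideal_ideal[OF r]])
    then show ?thesis
      using R.cgenideal_self[OF r] by (auto simp: annihilator_def)
  next
    case False
    \<comment> \<open>With K = r H the first premise of the condition is trivial, and the case
      assumption is exactly the second.\<close>
    then have "H \<subseteq> smult_image M r H \<or> smult_image M r H = {\<zero>\<^bsub>M\<^esub>}"
      using psi r smult_image_submodule[OF H r] unfolding psi_second_submodule_def by blast
    then show ?thesis
      using smult_image_subset[OF H r] by blast
  qed
  then show ?thesis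
    using psi by (simp add: second_submodule_def psi_second_submodule_def)
qed

end

theorem corollary2p7:
  fixes R :: "('a, 'r) ring_scheme" and M :: "('a, 'b, 'm) module_scheme" and H :: "'b set"
  assumes "module R M"
    and "submodule H R M"
    and "\<And>I J. ideal I R \<Longrightarrow> ideal J R \<Longrightarrow> residual M H I \<subseteq> residual M H J \<Longrightarrow> J \<subseteq> I"
  shows "second_submodule R M H \<longleftrightarrow> psi_second_submodule R M (psi1 R M) H"
  using module.second_imp_psi_second[OF assms(1)]
    module.psi1_second_imp_second[OF assms(1) _ assms(3)] by blast

end
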